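(* Let $\mathscr{H}$ be a complex Hilbert space, let $T\in\mathbb{B}(\mathscr{H})$, and let $T=H+iK$ be the Cartesian decomposition of $T$, i.e. $H=\frac{T+T^*}{2}$ and $K=\frac{T-T^*}{2i}$. Then $$\sup\{\Vert \alpha H+\beta K\Vert : \alpha,\beta\in\mathbb{R},\ \alpha^2+\beta^2=1\}=w(T).$$ In particular, $$\tfrac{1}{2}\Vert T+T^*\Vert\leq w(T)\quad\text{and}\quad \tfrac{1}{2}\Vert T-T^*\Vert\leq w(T).$$
   Context: $\mathbb{B}(\mathscr{H})$ is the $C^*$-algebra of bounded linear operators on the complex Hilbert space $\mathscr{H}$, and $\Vert\cdot\Vert$ is the operator norm. The numerical radius of $A\in\mathbb{B}(\mathscr{H})$ is $w(A)=\sup\{|\langle Ax,x\rangle| : x\in\mathscr{H},\ \Vert x\Vert=1\}$. *)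

theory Defs
  imports "HOL-Analysis.Analysis"
begin

text \<open>
  Complex inner product spaces, with the inner product linear in the first argument.
  The real structure underlying the complex one is that of the superclass, so that
  \<open>bounded_linear\<close> and \<open>onorm\<close> are available. Positive definiteness of the inner product
  follows from the last axiom, since \<open>norm\<close> is a norm and \<open>sqrt\<close> is negative
  on negative reals.
\<close>

class complex_inner = real_normed_vector +
  fixes scaleC :: "complex \<Rightarrow> 'a \<Rightarrow> 'a"  (infixr "*\<^sub>C" 75)
    and cinner :: "'a \<Rightarrow> 'a \<Rightarrow> complex"
  assumes scaleC_add_right: "c *\<^sub>C (x + y) = c *\<^sub>C x + c *\<^sub>C y"
    and scaleC_add_left: "(c + d) *\<^sub>C x = c *\<^sub>C x + d *\<^sub>C x"
    and scaleC_scaleC: "c *\<^sub>C d *\<^sub>C x = (c * d) *\<^sub>C x"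
    and scaleR_scaleC: "r *\<^sub>R x = complex_of_real r *\<^sub>C x"
    and cinner_commute: "cinner x y = cnj (cinner y x)"
    and cinner_add_left: "cinner (x + y) z = cinner x z + cinner y z"
    and cinner_scaleC_left: "cinner (c *\<^sub>C x) y = c * cinner x y"
    and norm_eq_sqrt_cinner: "norm x = sqrt (Re (cinner x x))"

class complex_hilbert = complex_inner + complete_space

definition bounded_clinear :: "('a::complex_inner \<Rightarrow> 'b::complex_inner) \<Rightarrow> bool" where
  "bounded_clinear T \<longleftrightarrow> bounded_linear T \<and> (\<forall>c x. T (c *\<^sub>C x) = c *\<^sub>C T x)"

text \<open>For bounded operators on a Hilbert space the adjoint exists and is unique.\<close>

definition cadjoint :: "('a::complex_hilbert \<Rightarrow> 'a) \<Rightarrow> 'a \<Rightarrow> 'a" where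
  "cadjoint T = (THE S. \<forall>x y. cinner (T x) y = cinner x (S y))"

text \<open>
  The supremum is taken in the nonnegative reals: inserting \<open>0\<close> matters only for the
  zero space, which has no unit vectors and where \<open>Sup {}\<close> is unspecified on the reals.
\<close>

definition numerical_radius :: "('a::complex_inner \<Rightarrow> 'a) \<Rightarrow> real" where
  "numerical_radius A = Sup (insert 0 {cmod (cinner (A x) x) |x. norm x = 1})"

end

theory Submission
  imports Defs
begin

text \<open>
  For \<open>\<alpha>\<^sup>2 + \<beta>\<^sup>2 = 1\<close> the operator \<open>A = \<alpha>H + \<beta>K\<close> is self-adjoint with
  \<open>\<langle>Ax, x\<rangle> = \<alpha> Re \<langle>Tx, x\<rangle> + \<beta> Im \<langle>Tx, x\<rangle>\<close>. The norm of a self-adjoint operator is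
  governed by its quadratic form (polarization), which gives \<open>\<parallel>A\<parallel> \<le> w(T)\<close>; conversely, for a
  given unit vector \<open>x\<close> the pair \<open>(\<alpha>, \<beta>)\<close> can be chosen so that
  \<open>\<langle>Ax, x\<rangle> = \<bar>\<langle>Tx, x\<rangle>\<bar>\<close>.
\<close>

section \<open>Complex inner product spaces\<close>

lemma cinner_add_right:
  fixes x y z :: "'a::complex_inner"
  shows "cinner x (y + z) = cinner x y + cinner x z"
  by (metis cinner_add_left cinner_commute complex_cnj_add)

lemma cinner_scaleC_right:
  fixes x y :: "'a::complex_inner"
  shows "cinner x (c *\<^sub>C y) = cnj c * cinner x y"
  by (metis cinner_commute cinner_scaleC_left complex_cnj_mult)

lemma cinner_scaleR_left:
  fixes x y :: "'a::complex_inner"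
  shows "cinner (r *\<^sub>R x) y = of_real r * cinner x y"
  by (simp add: scaleR_scaleC cinner_scaleC_left)

lemma cinner_scaleR_right:
  fixes x y :: "'a::complex_inner"
  shows "cinner x (r *\<^sub>R y) = of_real r * cinner x y"
  by (simp add: scaleR_scaleC cinner_scaleC_right)

lemma cinner_minus_left:
  fixes x y :: "'a::complex_inner"
  shows "cinner (- x) y = - cinner x y"
  using cinner_scaleR_left[of "-1" x y] by simp

lemma cinner_minus_right:
  fixes x y :: "'a::complex_inner"
  shows "cinner x (- y) = - cinner x y"
  using cinner_scaleR_right[of x "-1" y] by simp

lemma cinner_diff_left:
  fixes x y z :: "'a::complex_inner"
  shows "cinner (x - y) z = cinner x z - cinner y z"
  using cinner_add_left[of x "- y" z] by (simp add: cinner_minus_left)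

lemma cinner_diff_right:
  fixes x y z :: "'a::complex_inner"
  shows "cinner x (y - z) = cinner x y - cinner x z"
  using cinner_add_right[of x y "- z"] by (simp add: cinner_minus_right)

lemmas cinner_simps =
  cinner_add_left cinner_add_right cinner_diff_left cinner_diff_right
  cinner_scaleR_left cinner_scaleR_right cinner_scaleC_left cinner_scaleC_right

text \<open>As \<open>sqrt\<close> is negative on negative reals, nonnegativity of the norm forces
  \<open>Re (cinner x x)\<close> \<ge> 0, so the root can be squared away.\<close>

lemma Re_cinner_self:
  fixes x :: "'a::complex_inner"
  shows "Re (cinner x x) = (norm x)\<^sup>2"
  by (metis norm_eq_sqrt_cinner norm_ge_zero real_sqrt_ge_0_iff real_sqrt_pow2)

lemma cinner_self:
  fixes x :: "'a::complex_inner"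
  shows "cinner x x = of_real ((norm x)\<^sup>2)"
proof -
  have "Im (cinner x x) = - Im (cinner x x)"
    using arg_cong[OF cinner_commute[of x x], of Im] by simp
  then show ?thesis by (simp add: complex_eq_iff Re_cinner_self)
qed

lemma Re_cinner_commute:
  fixes x y :: "'a::complex_inner"
  shows "Re (cinner x y) = Re (cinner y x)"
  using arg_cong[OF cinner_commute[of x y], of Re] by simp

lemma power2_norm_add:
  fixes x y :: "'a::complex_inner"
  shows "(norm (x + y))\<^sup>2 = (norm x)\<^sup>2 + (norm y)\<^sup>2 + 2 * Re (cinner x y)"
  using Re_cinner_commute[of x y] by (simp add: Re_cinner_self[symmetric] cinner_simps)

lemma power2_norm_diff:
  fixes x y :: "'a::complex_inner"
  shows "(norm (x - y))\<^sup>2 = (norm x)\<^sup>2 + (norm y)\<^sup>2 - 2 * Re (cinner x y)"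
  using Re_cinner_commute[of x y] by (simp add: Re_cinner_self[symmetric] cinner_simps)

text \<open>The normed-space axioms give homogeneity for real scalars only; the complex case comes
  from sesquilinearity, where \<open>c * cnj c\<close> is the squared modulus.\<close>

lemma norm_scaleC:
  fixes x :: "'a::complex_inner"
  shows "norm (c *\<^sub>C x) = cmod c * norm x"
proof -
  have "(norm (c *\<^sub>C x))\<^sup>2 = Re (c * cnj c * cinner x x)"
    by (simp only: Re_cinner_self[symmetric] cinner_simps mult_ac)
  also have "\<dots> = (cmod c * norm x)\<^sup>2"
    by (simp only: complex_norm_square[symmetric] cinner_self power_mult_distrib
        of_real_mult[symmetric] Re_complex_of_real)
  finally have "(norm (c *\<^sub>C x))\<^sup>2 = (cmod c * norm x)\<^sup>2" .
  then show ?thesis by (metis mult_nonneg_nonneg norm_ge_zero power2_eq_imp_eq)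
qed

text \<open>The triangle inequality is an axiom here, so the real part of Cauchy-Schwarz is read off
  from its square.\<close>

lemma Re_cinner_le:
  fixes x y :: "'a::complex_inner"
  shows "Re (cinner x y) \<le> norm x * norm y"
proof -
  have "(norm (x + y))\<^sup>2 \<le> (norm x + norm y)\<^sup>2"
    by (intro power_mono norm_triangle_ineq) auto
  then show ?thesis by (simp add: power2_norm_add power2_sum)
qed

lemma cinner_Cauchy_Schwarz:
  fixes x y :: "'a::complex_inner"
  shows "cmod (cinner x y) \<le> norm x * norm y"
proof -
  let ?z = "cinner x y"
  \<comment> \<open>Scaling \<open>x\<close> by \<open>cnj ?z\<close> makes the inner product real,
    so the real-part bound controls the whole modulus after one factor \<open>cmod ?z\<close> is
    cancelled.\<close>
  have "(cmod ?z)\<^sup>2 = Re (cinner (cnj ?z *\<^sub>C x) y)"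
    by (simp add: cinner_simps cmod_power2) (simp add: power2_eq_square)
  also have "\<dots> \<le> cmod ?z * (norm x * norm y)"
    using Re_cinner_le[of "cnj ?z *\<^sub>C x" y] by (simp add: norm_scaleC mult_ac)
  finally have "cmod ?z * cmod ?z \<le> cmod ?z * (norm x * norm y)"
    by (simp add: power2_eq_square)
  then show ?thesis
    by (cases "?z = 0") auto
qed

lemma cinner_right_unique:
  fixes u v :: "'a::complex_inner"
  assumes "\<And>x. cinner x u = cinner x v"
  shows "u = v"
  using assms[of "u - v"] Re_cinner_self[of "u - v"] by (simp add: cinner_diff_right)

lemma bounded_linear_scaleC_right:
  "bounded_linear (\<lambda>x::'a::complex_inner. c *\<^sub>C x)"
  by (rule bounded_linear_intro[of _ "cmod c"])
    (simp_all add: scaleC_add_right scaleR_scaleC scaleC_scaleC norm_scaleC mult.commute)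

lemma bounded_linear_cinner_left:
  "bounded_linear (\<lambda>x::'a::complex_inner. cinner x y)"
  by (rule bounded_linear_intro[of _ "norm y"])
    (simp_all add: cinner_simps cinner_Cauchy_Schwarz scaleR_conv_of_real)

section \<open>Riesz representation and the adjoint\<close>

text \<open>
  The representing vector minimizes \<open>J x = \<parallel>x\<parallel>\<^sup>2 - 2 Re (f x)\<close>: by the parallelogram law
  minimizing sequences of \<open>J\<close> are Cauchy, and the first variation of \<open>J\<close> vanishes at the limit.
\<close>

lemma riesz_representation:
  fixes f :: "'a::complex_hilbert \<Rightarrow> complex"
  assumes f: "bounded_linear f" and fC: "\<And>c x. f (c *\<^sub>C x) = c * f x"
  obtains z where "\<And>x. f x = cinner x z"
proof -
  interpret f: bounded_linear f by (fact f)
  define J where "J x = (norm x)\<^sup>2 - 2 * Re (f x)" for x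
  define m where "m = (INF x. J x)"
  \<comment> \<open>Completing the square in \<open>norm x\<close> bounds \<open>J\<close> from
    below, so its infimum exists.\<close>
  have "- (onorm f)\<^sup>2 \<le> J x" for x
  proof -
    have "Re (f x) \<le> onorm f * norm x"
      using complex_Re_le_cmod[of "f x"] onorm[OF f, of x] by linarith
    moreover have "0 \<le> (norm x - onorm f)\<^sup>2" by simp
    ultimately show ?thesis by (simp add: J_def power2_diff mult_ac)
  qed
  then have bdd: "bdd_below (range J)" by (intro bdd_belowI) auto
  have m_le: "m \<le> J x" for x
    unfolding m_def using bdd by (intro cINF_lower) auto
  have parallelogram: "(norm (x - y))\<^sup>2 \<le> 2 * (J x - m) + 2 * (J y - m)" for x y
  proof -
    \<comment> \<open>The midpoint has value at least \<open>m\<close>; expressing that value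
      through \<open>J x\<close>, \<open>J y\<close> and the distance bounds the distance.\<close>
    have "J ((1/2) *\<^sub>R (x + y)) = (norm (x + y))\<^sup>2 / 4 - (Re (f x) + Re (f y))"
      by (simp add: J_def f.scaleR f.add power_mult_distrib power2_eq_square) argo
    also have "\<dots> = (J x + J y) / 2 - (norm (x - y))\<^sup>2 / 4"
      by (simp add: J_def power2_norm_add power2_norm_diff field_simps)
    finally show ?thesis using m_le[of "(1/2) *\<^sub>R (x + y)"] by argo
  qed
  have "\<exists>x. J x < m + 1 / Suc n" for n
    using cINF_less_iff[OF _ bdd, of "m + 1 / Suc n"] by (auto simp: m_def[symmetric])
  then obtain X where X: "\<And>n. J (X n) < m + 1 / Suc n" by metis
  have JX: "(\<lambda>n. J (X n)) \<longlonglongrightarrow> m"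
  proof (rule tendsto_sandwich[OF _ _ tendsto_const])
    show "(\<lambda>n. m + 1 / Suc n) \<longlonglongrightarrow> m"
      using tendsto_add[OF tendsto_const LIMSEQ_inverse_real_of_nat, of m]
      by (simp add: inverse_eq_divide)
  qed (intro always_eventually allI less_imp_le[OF X] m_le)+
  have "Cauchy X"
  proof (rule metric_CauchyI)
    fix e :: real assume "0 < e"
    \<comment> \<open>Two values within \<open>e\<^sup>2 / 4\<close> of \<open>m\<close> enter the
      parallelogram bound with factor 2 each, which adds up to \<open>e\<^sup>2\<close>.\<close>
    then have "eventually (\<lambda>n. J (X n) < m + e\<^sup>2 / 4) sequentially"
      by (intro order_tendstoD(2)[OF JX]) simp
    then obtain N where N: "\<And>n. N \<le> n \<Longrightarrow> J (X n) < m + e\<^sup>2 / 4"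
      by (auto simp: eventually_sequentially)
    have "dist (X i) (X j) < e" if "N \<le> i" "N \<le> j" for i j
    proof -
      have "(norm (X i - X j))\<^sup>2 < e\<^sup>2"
        using parallelogram[of "X i" "X j"] N[OF that(1)] N[OF that(2)] by argo
      then show ?thesis
        using \<open>0 < e\<close> by (simp add: dist_norm power_less_imp_less_base)
    qed
    then show "\<exists>M. \<forall>i\<ge>M. \<forall>j\<ge>M. dist (X i) (X j) < e" by blast
  qed
  then obtain z where z: "X \<longlonglongrightarrow> z"
    using Cauchy_convergent_iff convergent_def by blast
  have "(\<lambda>n. J (X n)) \<longlonglongrightarrow> J z"
    unfolding J_def by (intro tendsto_intros f.tendsto z)
  then have Jz: "J z = m" using JX LIMSEQ_unique by blast
  have Re_eq: "Re (f h) = Re (cinner h z)" for h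
  proof -
    define d where "d = Re (cinner h z) - Re (f h)"
    \<comment> \<open>Moving from \<open>z\<close> by \<open>t = - s * d\<close> along
      \<open>h\<close> changes \<open>J\<close> by
      \<open>s * d\<^sup>2 * (s * (norm h)\<^sup>2 - 2)\<close>, which is negative unless
      \<open>d = 0\<close>. The summand 1 in the denominator covers \<open>h = 0\<close>.\<close>
    define s where "s = 1 / (1 + (norm h)\<^sup>2)"
    have s: "0 < s" "s * (norm h)\<^sup>2 < 1"
      by (simp_all add: s_def add_pos_nonneg)
    have "J (z + t *\<^sub>R h) = J z + t\<^sup>2 * (norm h)\<^sup>2 + 2 * t * d" for t
      by (simp add: J_def d_def power2_norm_add cinner_simps f.add f.scaleR
          Re_cinner_commute[of z h] power_mult_distrib)
        (simp add: algebra_simps)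
    from this[of "- s * d"]
    have "J (z + (- s * d) *\<^sub>R h) = J z + s * d\<^sup>2 * (s * (norm h)\<^sup>2 - 2)"
      by (simp add: power2_eq_square algebra_simps)
    then have "0 \<le> s * d\<^sup>2 * (s * (norm h)\<^sup>2 - 2)"
      using m_le[of "z + (- s * d) *\<^sub>R h"] Jz by simp
    then have "d = 0"
      using s by (auto simp: zero_le_mult_iff mult_le_0_iff)
    then show ?thesis by (simp add: d_def)
  qed
  \<comment> \<open>Complex linearity recovers imaginary parts: the real part at
    \<open>\<i> *\<^sub>C h\<close> is minus the imaginary part at \<open>h\<close>.\<close>
  have "f h = cinner h z" for h
    using Re_eq[of h] Re_eq[of "\<i> *\<^sub>C h"]
    by (simp add: fC cinner_simps complex_eq_iff)
  then show thesis by (rule that)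
qed

text \<open>This discharges the definite description: Riesz for each fixed \<open>y\<close> gives
  existence, and \<open>cinner_right_unique\<close> gives uniqueness.\<close>

lemma cadjoint:
  fixes T :: "'a::complex_hilbert \<Rightarrow> 'a"
  assumes "bounded_clinear T"
  shows "cinner (T x) y = cinner x (cadjoint T y)"
proof -
  have T: "bounded_linear T" "\<And>c x. T (c *\<^sub>C x) = c *\<^sub>C T x"
    using assms by (auto simp: bounded_clinear_def)
  have "\<exists>z. \<forall>x. cinner (T x) y = cinner x z" for y
  proof (rule riesz_representation[of "\<lambda>x. cinner (T x) y"])
    show "bounded_linear (\<lambda>x. cinner (T x) y)"
      by (rule bounded_linear_compose[OF bounded_linear_cinner_left T(1)])
  qed (auto simp: T(2) cinner_scaleC_left)
  then obtain S where S: "\<forall>x y. cinner (T x) y = cinner x (S y)" by metis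
  have "\<forall>x y. cinner (T x) y = cinner x (cadjoint T y)"
    unfolding cadjoint_def
  proof (rule theI[where a = S])
    show "S' = S" if "\<forall>x y. cinner (T x) y = cinner x (S' y)" for S'
      using that S by (intro ext cinner_right_unique) metis
  qed (fact S)
  then show ?thesis by blast
qed

lemma cadjoint_left:
  fixes T :: "'a::complex_hilbert \<Rightarrow> 'a"
  assumes "bounded_clinear T"
  shows "cinner (cadjoint T x) y = cinner x (T y)"
  by (metis assms cadjoint cinner_commute)

lemma bounded_linear_cadjoint:
  fixes T :: "'a::complex_hilbert \<Rightarrow> 'a"
  assumes T: "bounded_clinear T"
  shows "bounded_linear (cadjoint T)"
proof (rule bounded_linear_intro[of _ "onorm T"])
  show "cadjoint T (x + y) = cadjoint T x + cadjoint T y" for x y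
    by (rule cinner_right_unique) (simp add: cadjoint[OF T, symmetric] cinner_simps)
  show "cadjoint T (r *\<^sub>R x) = r *\<^sub>R cadjoint T x" for r x
    by (rule cinner_right_unique) (simp add: cadjoint[OF T, symmetric] cinner_simps)
  fix y
  let ?s = "norm (cadjoint T y)"
  have bl: "bounded_linear T" using T by (simp add: bounded_clinear_def)
  \<comment> \<open>Testing the adjoint identity at \<open>cadjoint T y\<close> itself bounds
    \<open>?s\<^sup>2\<close> by a multiple of \<open>?s\<close>, and one factor cancels.\<close>
  have "?s\<^sup>2 = Re (cinner (T (cadjoint T y)) y)"
    by (simp add: cadjoint[OF T] Re_cinner_self)
  also have "\<dots> \<le> norm (T (cadjoint T y)) * norm y" by (rule Re_cinner_le)
  also have "\<dots> \<le> onorm T * ?s * norm y"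
    by (intro mult_right_mono onorm[OF bl]) simp
  finally have "?s * ?s \<le> ?s * (norm y * onorm T)"
    by (simp add: power2_eq_square mult_ac)
  then show "?s \<le> norm y * onorm T"
    using onorm_pos_le[OF bl] by (cases "?s = 0") (auto simp: mult_le_cancel_left)
qed

section \<open>Numerical radius\<close>

lemma onorm_symmetric_le:
  fixes A :: "'a::complex_inner \<Rightarrow> 'a"
  assumes A: "bounded_linear A"
    and symm: "\<And>x y. cinner (A x) y = cinner x (A y)"
    and bound: "\<And>x. cmod (cinner (A x) x) \<le> c * (norm x)\<^sup>2"
    and c: "0 \<le> c"
  shows "onorm A \<le> c"
proof (rule onorm_bound[OF c])
  interpret A: bounded_linear A by (fact A)
  have polar: "2 * Re (cinner (A x) y) \<le> c * ((norm x)\<^sup>2 + (norm y)\<^sup>2)" for x y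
  proof -
    \<comment> \<open>Subtracting the two forms leaves only cross terms; symmetry makes their real
      parts equal, hence the factor 4.\<close>
    have "4 * Re (cinner (A x) y) = Re (cinner (A (x + y)) (x + y)) - Re (cinner (A (x - y)) (x - y))"
      using symm[of y x] Re_cinner_commute[of y "A x"] by (simp add: A.add A.diff cinner_simps)
    also have "\<dots> \<le> c * (norm (x + y))\<^sup>2 + c * (norm (x - y))\<^sup>2"
      using bound[of "x + y"] bound[of "x - y"] abs_Re_le_cmod[of "cinner (A (x + y)) (x + y)"]
        abs_Re_le_cmod[of "cinner (A (x - y)) (x - y)"] by linarith
    also have "\<dots> = 2 * (c * ((norm x)\<^sup>2 + (norm y)\<^sup>2))"
      by (simp add: power2_norm_add power2_norm_diff algebra_simps)
    finally show ?thesis by simp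
  qed
  fix x
  show "norm (A x) \<le> c * norm x"
  proof (cases "A x = 0 \<or> x = 0")
    case True
    then show ?thesis using c by (auto simp: A.zero)
  next
    case False
    let ?a = "norm (A x)" and ?n = "norm x"
    \<comment> \<open>The two vectors are rescaled to the common norm \<open>?a * ?n\<close>, so
      that bounding by the sum of squares in \<open>polar\<close> loses nothing.\<close>
    have "2 * (?a * ?n * ?a\<^sup>2) \<le> c * (2 * (?a\<^sup>2 * ?n\<^sup>2))"
      using polar[of "?a *\<^sub>R x" "?n *\<^sub>R A x"]
      by (simp add: A.scaleR cinner_simps Re_cinner_self power_mult_distrib mult_ac)
    then have "(?a\<^sup>2 * ?n) * ?a \<le> (?a\<^sup>2 * ?n) * (c * ?n)"
      by (simp add: power2_eq_square mult_ac)
    with False show ?thesis by (simp add: mult_le_cancel_left)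
  qed
qed

lemma bdd_above_numerical_range:
  fixes T :: "'a::complex_inner \<Rightarrow> 'a"
  assumes "bounded_linear T"
  shows "bdd_above (insert 0 {cmod (cinner (T x) x) |x. norm x = 1})"
proof -
  have "cmod (cinner (T x) x) \<le> onorm T" if "norm x = 1" for x
    using cinner_Cauchy_Schwarz[of "T x" x] onorm[OF assms, of x] that by simp
  then show ?thesis
    using onorm_pos_le[OF assms] by (intro bdd_aboveI[of _ "onorm T"]) blast
qed

lemma numerical_radius_nonneg:
  fixes T :: "'a::complex_inner \<Rightarrow> 'a"
  assumes "bounded_linear T"
  shows "0 \<le> numerical_radius T"
  unfolding numerical_radius_def
  by (rule cSup_upper[OF _ bdd_above_numerical_range[OF assms]]) simp

text \<open>Normalizing \<open>x\<close> turns the supremum over unit vectors into the homogeneous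
  bound that \<open>onorm_symmetric_le\<close> asks for.\<close>

lemma cmod_cinner_le_numerical_radius:
  fixes T :: "'a::complex_inner \<Rightarrow> 'a"
  assumes T: "bounded_linear T"
  shows "cmod (cinner (T x) x) \<le> numerical_radius T * (norm x)\<^sup>2"
proof (cases "x = 0")
  case True
  then show ?thesis
    using cinner_Cauchy_Schwarz[of "T x" x] by simp
next
  case False
  define u where "u = (1 / norm x) *\<^sub>R x"
  have u: "norm u = 1" and x: "x = norm x *\<^sub>R u" using False by (simp_all add: u_def)
  have "cmod (cinner (T u) u) \<le> numerical_radius T"
    unfolding numerical_radius_def
    by (rule cSup_upper[OF _ bdd_above_numerical_range[OF T]]) (use u in auto)
  moreover
  have "cinner (T x) x = of_real ((norm x)\<^sup>2) * cinner (T u) u"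
    by (subst (1 2) x)
      (simp add: linear_simps(5)[OF T] cinner_simps power2_eq_square)
  then have "cmod (cinner (T x) x) = cmod (cinner (T u) u) * (norm x)\<^sup>2"
    by (simp add: norm_mult norm_power)
  ultimately show ?thesis
    by (simp add: mult_right_mono)
qed

text \<open>The pair is the cosine and sine of the argument of \<open>z\<close>, the equality case
  of Cauchy-Schwarz in the plane; for \<open>z = 0\<close> any unit pair serves.\<close>

lemma exists_unit_pair_cmod:
  obtains \<alpha> \<beta> :: real where "\<alpha>\<^sup>2 + \<beta>\<^sup>2 = 1" "\<alpha> * Re z + \<beta> * Im z = cmod z"
proof (cases "z = 0")
  case True
  then show ?thesis using that[of 1 0] by simp
next
  case False
  show ?thesis
  proof (rule that[of "Re z / cmod z" "Im z / cmod z"])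
    show "(Re z / cmod z)\<^sup>2 + (Im z / cmod z)\<^sup>2 = 1"
      using False by (simp add: power_divide add_divide_distrib[symmetric] cmod_power2[symmetric])
    have "Re z / cmod z * Re z + Im z / cmod z * Im z = (cmod z)\<^sup>2 / cmod z"
      unfolding cmod_power2 by (simp add: add_divide_distrib power2_eq_square)
    then show "Re z / cmod z * Re z + Im z / cmod z * Im z = cmod z"
      using False by (simp add: power2_eq_square)
  qed
qed

theorem theorem2p1:
  fixes T H K :: "'a::complex_hilbert \<Rightarrow> 'a"
  assumes "bounded_clinear T"
    and "H = (\<lambda>x. (1 / 2) *\<^sub>R (T x + cadjoint T x))"
    and "K = (\<lambda>x. (1 / (2 * \<i>)) *\<^sub>C (T x - cadjoint T x))"
  shows "Sup {onorm (\<lambda>x. \<alpha> *\<^sub>R H x + \<beta> *\<^sub>R K x) |\<alpha> \<beta> :: real. \<alpha>\<^sup>2 + \<beta>\<^sup>2 = 1} = numerical_radius T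
    \<and> 1 / 2 * onorm (\<lambda>x. T x + cadjoint T x) \<le> numerical_radius T
    \<and> 1 / 2 * onorm (\<lambda>x. T x - cadjoint T x) \<le> numerical_radius T"
proof -
  define A where "A \<alpha> \<beta> x = \<alpha> *\<^sub>R H x + \<beta> *\<^sub>R K x" for \<alpha> \<beta> :: real and x
  let ?N = "{onorm (A \<alpha> \<beta>) |\<alpha> \<beta>. \<alpha>\<^sup>2 + \<beta>\<^sup>2 = 1}"
  note adj = cadjoint[OF assms(1), symmetric] cadjoint_left[OF assms(1)]
  have T: "bounded_linear T" using assms(1) by (simp add: bounded_clinear_def)
  note S = bounded_linear_cadjoint[OF assms(1)]
  have A: "bounded_linear (A \<alpha> \<beta>)" for \<alpha> \<beta>
    unfolding A_def assms(2,3)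
    by (intro bounded_linear_add bounded_linear_const_scaleR bounded_linear_sub T S
        bounded_linear_compose[OF bounded_linear_scaleC_right])
  have A_form: "cinner (A \<alpha> \<beta> x) x = of_real (\<alpha> * Re (cinner (T x) x) + \<beta> * Im (cinner (T x) x))"
    for \<alpha> \<beta> x
  proof -
    have "cinner x (T x) = cnj (cinner (T x) x)" by (rule cinner_commute)
    then show ?thesis
      by (simp add: A_def assms(2,3) cinner_simps adj complex_eq_iff)
  qed
  \<comment> \<open>For the \<open>K\<close> part, \<open>T - cadjoint T\<close> changes sign when
    moved across the inner product, and so does \<open>1 / (2 * \<i>)\<close> under
    conjugation.\<close>
  have A_symm: "cinner (A \<alpha> \<beta> x) y = cinner x (A \<alpha> \<beta> y)" for \<alpha> \<beta> x y
    by (simp add: A_def assms(2,3) cinner_simps adj) (simp add: field_simps)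
  have A_le: "onorm (A \<alpha> \<beta>) \<le> numerical_radius T" if ab: "\<alpha>\<^sup>2 + \<beta>\<^sup>2 = 1" for \<alpha> \<beta>
  proof (rule onorm_symmetric_le[OF A A_symm])
    fix x
    let ?z = "cinner (T x) x"
    \<comment> \<open>The combination is the real part of \<open>?z\<close> times \<alpha> -
      i\<beta>, a number of modulus 1.\<close>
    have "\<bar>\<alpha> * Re ?z + \<beta> * Im ?z\<bar> \<le> cmod (Complex \<alpha> (- \<beta>) * ?z)"
      using abs_Re_le_cmod[of "Complex \<alpha> (- \<beta>) * ?z"] by simp
    also have "\<dots> = cmod ?z" using ab by (simp only: norm_mult complex_norm) simp
    finally show "cmod (cinner (A \<alpha> \<beta> x) x) \<le> numerical_radius T * (norm x)\<^sup>2"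
      using cmod_cinner_le_numerical_radius[OF T, of x] unfolding A_form norm_of_real
      by linarith
  qed (rule numerical_radius_nonneg[OF T])
  have bdd: "bdd_above ?N" using A_le by (auto intro!: bdd_aboveI[of _ "numerical_radius T"])
  have mem: "onorm (A \<alpha> \<beta>) \<in> ?N" if "\<alpha>\<^sup>2 + \<beta>\<^sup>2 = 1" for \<alpha> \<beta> using that by blast
  have "onorm (A 1 0) \<in> ?N" by (rule mem) simp
  then have nonempty: "?N \<noteq> {}" by blast
  have "Sup ?N = numerical_radius T"
  proof (rule antisym)
    show "Sup ?N \<le> numerical_radius T"
      using A_le by (intro cSup_least[OF nonempty]) auto
    have "cmod (cinner (T x) x) \<le> Sup ?N" if x: "norm x = 1" for x
    proof -
      obtain \<alpha> \<beta> where ab: "\<alpha>\<^sup>2 + \<beta>\<^sup>2 = 1"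
        "\<alpha> * Re (cinner (T x) x) + \<beta> * Im (cinner (T x) x) = cmod (cinner (T x) x)"
        by (rule exists_unit_pair_cmod)
      have "cmod (cinner (T x) x) = Re (cinner (A \<alpha> \<beta> x) x)"
        by (simp add: A_form ab(2))
      also have "\<dots> \<le> onorm (A \<alpha> \<beta>)"
        using Re_cinner_le[of "A \<alpha> \<beta> x" x] onorm[OF A, of \<alpha> \<beta> x] x by simp
      also have "\<dots> \<le> Sup ?N" by (rule cSup_upper[OF mem[OF ab(1)] bdd])
      finally show ?thesis .
    qed
    \<comment> \<open>This accounts for the 0 inserted into the set defining
      \<open>numerical_radius\<close>.\<close>
    moreover have "0 \<le> Sup ?N"
      using onorm_pos_le[OF A, of 1 0] cSup_upper[OF \<open>onorm (A 1 0) \<in> ?N\<close> bdd] by linarith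
    ultimately show "numerical_radius T \<le> Sup ?N"
      unfolding numerical_radius_def by (intro cSup_least) auto
  qed
  moreover have "1 / 2 * onorm (\<lambda>x. T x + cadjoint T x) \<le> numerical_radius T"
  proof -
    have "A 1 0 = (\<lambda>x. (1 / 2) *\<^sub>R (T x + cadjoint T x))"
      by (simp add: fun_eq_iff A_def assms(2))
    then show ?thesis
      using A_le[of 1 0] onorm_scaleR[OF bounded_linear_add[OF T S], of "1/2"] by simp
  qed
  moreover have "1 / 2 * onorm (\<lambda>x. T x - cadjoint T x) \<le> numerical_radius T"
  proof -
    \<comment> \<open>Here \<open>A 0 1\<close> is \<open>K\<close>, whose scalar
      \<open>1 / (2 * \<i>)\<close> is not real but has modulus 1/2, so norms are compared
      pointwise.\<close>
    have "norm (T x - cadjoint T x) \<le> 2 * numerical_radius T * norm x" for x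
    proof -
      have "norm (A 0 1 x) = norm (T x - cadjoint T x) / 2"
        by (simp add: A_def assms(3) norm_scaleC norm_divide norm_mult)
      moreover have "norm (A 0 1 x) \<le> numerical_radius T * norm x"
        using onorm[OF A, of 0 1 x] mult_right_mono[OF A_le[of 0 1] norm_ge_zero[of x]] by simp
      ultimately show ?thesis by simp
    qed
    then show ?thesis
      using onorm_bound[of "2 * numerical_radius T" "\<lambda>x. T x - cadjoint T x"]
        numerical_radius_nonneg[OF T] by simp
  qed
  ultimately show ?thesis by (simp add: A_def[abs_def])
qed

end
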